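(* Let $a,k \in \mathbb{N}$ and let $M$ be a connected strong $k$-chromatic-choosable graph. Then $$\frac{(P_\ell(M,k+a-1))^a}{2^{k-1}} \leq f_a(M).$$
   Context: All graphs are finite, simple and nonempty; $\mathbb{N}=\{1,2,\dots\}$. A list assignment $L$ for a graph assigns to each vertex $v$ a set $L(v)$ of colors; a proper $L$-coloring is a proper coloring $c$ with $c(v)\in L(v)$ for all $v$; $G$ is $L$-colorable if one exists. $L$ is a $k$-assignment if $|L(v)|=k$ for all $v$, and is constant if all lists are equal. $\chi_\ell(G)$ is the least $k$ such that $G$ is $L$-colorable for every $k$-assignment $L$. The list color function $P_\ell(G,k)$ is the minimum, over all $k$-assignments $L$ for $G$, of the number of proper $L$-colorings of $G$. A graph $G$ is strong $k$-chromatic-choosable if $\chi(G)=k$ and every $(k-1)$-assignment $L$ for which $G$ is not $L$-colorable is constant. The Cartesian product $G \square H$ has vertex set $V(G)\times V(H)$, with $(u,v)$ adjacent to $(u',v')$ iff either $u=u'$ and $vv'\in E(H)$, or $v=v'$ and $uu'\in E(G)$. $K_{a,b}$ is the complete bipartite graph with parts of sizes $a$ and $b$. $f_a(G)$ denotes the smallest $b\in\mathbb{N}$ such that $\chi_\ell(G \square K_{a,b}) = \chi_\ell(G) + a$. *)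

theory Defs
  imports "Graph_Theory.Digraph_Component" "Graph_Theory.Kuratowski" "HOL-Library.FuncSet"
begin

text \<open>
  A finite simple graph is a \<^const>\<open>pair_graph\<close>: a finite, symmetric, irreflexive arc relation
  \<^const>\<open>parcs\<close> on the vertex set \<^const>\<open>pverts\<close>, an edge \<open>uv\<close> being the pair of arcs
  \<open>(u, v)\<close> and \<open>(v, u)\<close>.  All lists are finite and all graphs are finite, so taking the natural
  numbers as the set of colors is no restriction.
\<close>

definition proper_coloring :: "'a pair_pre_digraph \<Rightarrow> ('a \<Rightarrow> 'c) \<Rightarrow> bool" where
  "proper_coloring G c \<longleftrightarrow> (\<forall>u v. (u, v) \<in> parcs G \<longrightarrow> c u \<noteq> c v)"

definition chromatic_number :: "'a pair_pre_digraph \<Rightarrow> nat" where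
  "chromatic_number G =
    (LEAST k. \<exists>c :: 'a \<Rightarrow> nat. c \<in> pverts G \<rightarrow> {..<k} \<and> proper_coloring G c)"

text \<open>Finiteness is stated separately because \<^const>\<open>card\<close> is \<open>0\<close> on infinite sets and \<open>k = 0\<close> occurs.\<close>

definition k_assignment :: "'a pair_pre_digraph \<Rightarrow> nat \<Rightarrow> ('a \<Rightarrow> 'c set) \<Rightarrow> bool" where
  "k_assignment G k L \<longleftrightarrow> (\<forall>v \<in> pverts G. finite (L v) \<and> card (L v) = k)"

definition constant_assignment :: "'a pair_pre_digraph \<Rightarrow> ('a \<Rightarrow> 'c set) \<Rightarrow> bool" where
  "constant_assignment G L \<longleftrightarrow> (\<forall>u \<in> pverts G. \<forall>v \<in> pverts G. L u = L v)"

text \<open>The extensional function space makes colorings that agree on all vertices equal, so that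
  the cardinality of this set is the number of proper \<open>L\<close>-colorings.\<close>

definition list_colorings :: "'a pair_pre_digraph \<Rightarrow> ('a \<Rightarrow> 'c set) \<Rightarrow> ('a \<Rightarrow> 'c) set" where
  "list_colorings G L = {c \<in> Pi\<^sub>E (pverts G) L. proper_coloring G c}"

definition list_colorable :: "'a pair_pre_digraph \<Rightarrow> ('a \<Rightarrow> 'c set) \<Rightarrow> bool" where
  "list_colorable G L \<longleftrightarrow> list_colorings G L \<noteq> {}"

definition list_chromatic_number :: "'a pair_pre_digraph \<Rightarrow> nat" where
  "list_chromatic_number G =
    (LEAST k. \<forall>L :: 'a \<Rightarrow> nat set. k_assignment G k L \<longrightarrow> list_colorable G L)"

definition list_color_function :: "'a pair_pre_digraph \<Rightarrow> nat \<Rightarrow> nat" where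
  "list_color_function G k =
    (LEAST n. \<exists>L :: 'a \<Rightarrow> nat set. k_assignment G k L \<and> n = card (list_colorings G L))"

definition strong_chromatic_choosable :: "nat \<Rightarrow> 'a pair_pre_digraph \<Rightarrow> bool" where
  "strong_chromatic_choosable k G \<longleftrightarrow>
    chromatic_number G = k \<and>
    (\<forall>L :: 'a \<Rightarrow> nat set. k_assignment G (k - 1) L \<longrightarrow> \<not> list_colorable G L \<longrightarrow>
       constant_assignment G L)"

definition cartesian_product ::
  "'a pair_pre_digraph \<Rightarrow> 'b pair_pre_digraph \<Rightarrow> ('a \<times> 'b) pair_pre_digraph" (infixl \<open>\<box>\<close> 70) where
  "G \<box> H =
    \<lparr>pverts = pverts G \<times> pverts H,
     parcs = {((u, v), (u', v')). (u, v) \<in> pverts G \<times> pverts H \<and> (u', v') \<in> pverts G \<times> pverts H \<and>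
       (u = u' \<and> (v, v') \<in> parcs H \<or> v = v' \<and> (u, u') \<in> parcs G)}\<rparr>"

definition complete_bipartite :: "nat \<Rightarrow> nat \<Rightarrow> (nat + nat) pair_pre_digraph" where
  "complete_bipartite a b =
    \<lparr>pverts = Inl ` {..<a} \<union> Inr ` {..<b},
     parcs = (Inl ` {..<a}) \<times> (Inr ` {..<b}) \<union> (Inr ` {..<b}) \<times> (Inl ` {..<a})\<rparr>"

definition f_number :: "nat \<Rightarrow> 'a pair_pre_digraph \<Rightarrow> nat" where
  "f_number a G =
    (LEAST b. b \<ge> 1 \<and>
       list_chromatic_number (G \<box> complete_bipartite a b) = list_chromatic_number G + a)"

lemma complete_bipartite_is_complete_bipartite_digraph:
  "complete_bipartite_digraph a b (with_proj (complete_bipartite a b))"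
  unfolding complete_bipartite_digraph_pair_def
  by (intro conjI exI[where x = "Inl ` {..<a}"] exI[where x = "Inr ` {..<b}"])
    (auto simp: complete_bipartite_def card_image)

lemma pair_graph_complete_bipartite: "pair_graph (complete_bipartite a b)"
  by (rule pair_graphI_complete_bipartite[OF complete_bipartite_is_complete_bipartite_digraph])

lemma pair_graph_cartesian_product:
  assumes "pair_graph G" "pair_graph H"
  shows "pair_graph (G \<box> H)"
proof -
  interpret G: pair_graph G by fact
  interpret H: pair_graph H by fact
  have "parcs (G \<box> H) \<subseteq> pverts (G \<box> H) \<times> pverts (G \<box> H)"
    by (auto simp: cartesian_product_def)
  moreover have fin: "finite (pverts (G \<box> H))"
    using G.pair_finite_verts H.pair_finite_verts by (simp add: cartesian_product_def)
  ultimately have "finite (parcs (G \<box> H))"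
    by (meson finite_SigmaI finite_subset)
  then show ?thesis
    using fin
    by unfold_locales
      (auto simp: cartesian_product_def symmetric_def sym_def
        dest: G.arcs_symmetric H.arcs_symmetric G.no_loops' H.no_loops')
qed

lemma list_color_function_attained:
  fixes G :: "'a pair_pre_digraph"
  shows "\<exists>L :: 'a \<Rightarrow> nat set. k_assignment G k L \<and> card (list_colorings G L) = list_color_function G k"
proof -
  have "k_assignment G k (\<lambda>_. {..<k})"
    by (simp add: k_assignment_def)
  then have "\<exists>n. \<exists>L :: 'a \<Rightarrow> nat set. k_assignment G k L \<and> n = card (list_colorings G L)"
    by blast
  from LeastI_ex[OF this] show ?thesis
    unfolding list_color_function_def by metis
qed

end

theory Submission
  imports Defs
begin

text \<open>
  Let \<open>L\<close> be a \<open>(k + a - 1)\<close>-assignment for \<open>M \<box> K\<^bsub>a,b\<^esub>\<close> without a proper coloring.  Color the \<open>a\<close>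
  copies of \<open>M\<close> over the first part, in at least \<open>P\<^sub>\<ell>(M, k + a - 1)\<^sup>a\<close> ways.  Each such tuple
  must be bad for one of the \<open>b\<close> other copies, which then keeps lists of size at least \<open>k - 1\<close> but
  has no coloring; strong chromatic-choosability forces all remaining lists to equal a single
  \<open>(k - 1)\<close>-set \<open>A\<close>.  So the tuple uses \<open>a\<close> different colors at every vertex \<open>v\<close>, and hence the \<open>a\<close> lists
  over \<open>v\<close> in the first part are pairwise disjoint.  Consequently the tuple is recovered from \<open>A\<close>, and
  \<open>A\<close> from the colors at one vertex \<open>w\<close>.  If \<open>s\<^sub>i \<ge> 1\<close> colors of the list of \<open>w\<close> in the bad copy lie in
  the \<open>i\<close>-th list over \<open>w\<close>, there are at most \<open>\<Prod>s\<^sub>i \<le> \<Prod>2\<^bsup>s\<^sub>i - 1\<^esup> \<le> 2\<^bsup>k - 1\<^esup>\<close> such choices.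

  The number \<open>f\<^sub>a(M)\<close> is defined by a least element, so one also needs that some \<open>b\<close> attains
  \<open>k + a\<close>: use pairwise disjoint constant lists on the first part and, for each tuple of colorings, a
  copy whose lists are the colors of the tuple together with a fixed \<open>(k - 1)\<close>-set.
\<close>

section \<open>List colorings\<close>

text \<open>Arcs join vertices only, so restricting a function to \<open>pverts G\<close> keeps it
  proper; existence questions can thus ignore extensionality.\<close>

lemma list_colorable_iff:
  assumes "pair_graph G"
  shows "list_colorable G L \<longleftrightarrow> (\<exists>c. (\<forall>v\<in>pverts G. c v \<in> L v) \<and> proper_coloring G c)"
proof
  assume "list_colorable G L"
  then show "\<exists>c. (\<forall>v\<in>pverts G. c v \<in> L v) \<and> proper_coloring G c"
    by (auto simp: list_colorable_def list_colorings_def)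
next
  interpret pair_graph G by fact
  assume "\<exists>c. (\<forall>v\<in>pverts G. c v \<in> L v) \<and> proper_coloring G c"
  then obtain c where c: "\<forall>v\<in>pverts G. c v \<in> L v" "proper_coloring G c"
    by blast
  have "restrict c (pverts G) \<in> list_colorings G L"
    using c by (auto simp: list_colorings_def proper_coloring_def dest: in_arcsD1 in_arcsD2)
  then show "list_colorable G L"
    by (auto simp: list_colorable_def)
qed

lemma list_colorable_mono:
  assumes "list_colorable G L" "pair_graph G" "\<And>v. v \<in> pverts G \<Longrightarrow> L v \<subseteq> L' v"
  shows "list_colorable G L'"
proof -
  obtain c where "\<forall>v\<in>pverts G. c v \<in> L v" "proper_coloring G c"
    using assms(1) by (auto simp: list_colorable_iff[OF assms(2)])
  then show ?thesis
    using assms(3) by (auto simp: list_colorable_iff[OF assms(2)] intro!: exI[of _ c])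
qed

lemma k_subassignment_exists:
  assumes "\<And>v. v \<in> pverts G \<Longrightarrow> finite (L v) \<and> m \<le> card (L v)"
  obtains L' where "k_assignment G m L'" "\<And>v. v \<in> pverts G \<Longrightarrow> L' v \<subseteq> L v"
proof -
  have "\<forall>v\<in>pverts G. \<exists>B. B \<subseteq> L v \<and> finite B \<and> card B = m"
    using assms by (metis obtain_subset_with_card_n)
  then obtain L' where "\<forall>v\<in>pverts G. L' v \<subseteq> L v \<and> finite (L' v) \<and> card (L' v) = m"
    by metis
  then show thesis
    by (intro that[of L']) (auto simp: k_assignment_def)
qed

lemma choosable_mono:
  fixes G :: "'a pair_pre_digraph" and L :: "'a \<Rightarrow> nat set"
  assumes "pair_graph G" "\<And>L :: 'a \<Rightarrow> nat set. k_assignment G m L \<Longrightarrow> list_colorable G L"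
    and "k_assignment G n L" "m \<le> n"
  shows "list_colorable G L"
proof -
  obtain L' where L': "k_assignment G m L'" "\<And>v. v \<in> pverts G \<Longrightarrow> L' v \<subseteq> L v"
    using assms(3,4) by (elim k_subassignment_exists[of G L m, rotated]) (auto simp: k_assignment_def)
  show ?thesis
    by (rule list_colorable_mono[OF assms(2)[OF L'(1)] assms(1) L'(2)])
qed

section \<open>List chromatic number, list color function and chromatic number\<close>

text \<open>Shrinking lists preserves uncolorability, so one uncolorable
  \<open>(n - 1)\<close>-assignment rules out every \<open>m < n\<close>.\<close>

lemma list_chromatic_number_eqI:
  fixes G :: "'a pair_pre_digraph" and L :: "'a \<Rightarrow> nat set"
  assumes "pair_graph G"
    and "\<And>L :: 'a \<Rightarrow> nat set. k_assignment G n L \<Longrightarrow> list_colorable G L"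
    and "k_assignment G (n - 1) L" "\<not> list_colorable G L" "n \<ge> 1"
  shows "list_chromatic_number G = n"
  unfolding list_chromatic_number_def
proof (rule Least_equality)
  fix m assume m: "\<forall>L :: 'a \<Rightarrow> nat set. k_assignment G m L \<longrightarrow> list_colorable G L"
  show "n \<le> m"
  proof (rule ccontr)
    assume "\<not> n \<le> m"
    then have "m \<le> n - 1" by simp
    with m show False
      using choosable_mono[OF assms(1) _ assms(3)] assms(4) by blast
  qed
qed (use assms(2) in blast)

lemma list_chromatic_number_le:
  fixes G :: "'a pair_pre_digraph"
  assumes "\<And>L :: 'a \<Rightarrow> nat set. k_assignment G n L \<Longrightarrow> list_colorable G L"
  shows "list_chromatic_number G \<le> n"
  unfolding list_chromatic_number_def using assms by (intro Least_le) blast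

lemma list_color_function_le:
  fixes L :: "'a \<Rightarrow> nat set"
  assumes "k_assignment G k L"
  shows "list_color_function G k \<le> card (list_colorings G L)"
  unfolding list_color_function_def using assms by (intro Least_le) blast

lemma finite_list_colorings:
  assumes "pair_graph G" "\<And>v. v \<in> pverts G \<Longrightarrow> finite (L v)"
  shows "finite (list_colorings G L)"
proof -
  interpret pair_graph G by fact
  have "finite (Pi\<^sub>E (pverts G) L)"
    using assms(2) by (intro finite_PiE) auto
  then show ?thesis
    by (rule finite_subset[rotated]) (auto simp: list_colorings_def)
qed

text \<open>Numbering the elements of \<open>A\<close> would turn an \<open>L\<close>-coloring into
  a coloring with \<open>card A\<close> colors.\<close>

lemma not_list_colorable_below_chromatic_number:
  assumes "pair_graph G" "finite A" "card A < chromatic_number G"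
    and "\<And>v. v \<in> pverts G \<Longrightarrow> L v \<subseteq> A"
  shows "\<not> list_colorable G L"
proof
  assume "list_colorable G L"
  then obtain c where c: "\<forall>v\<in>pverts G. c v \<in> A" "proper_coloring G c"
    using assms(4) by (auto simp: list_colorable_iff[OF assms(1)])
  obtain h where h: "bij_betw h A {0..<card A}"
    using ex_bij_betw_finite_nat[OF assms(2)] by blast
  interpret pair_graph G by fact
  have "proper_coloring G (h \<circ> c)"
    unfolding proper_coloring_def
  proof (intro allI impI)
    fix u v assume uv: "(u, v) \<in> parcs G"
    then have "c u \<in> A" "c v \<in> A" "c u \<noteq> c v"
      using c by (auto simp: proper_coloring_def dest: in_arcsD1 in_arcsD2)
    then show "(h \<circ> c) u \<noteq> (h \<circ> c) v"
      using h by (auto simp: bij_betw_def inj_on_def)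
  qed
  moreover have "h \<circ> c \<in> pverts G \<rightarrow> {..<card A}"
    using c h by (auto dest: bij_betwE)
  ultimately have "chromatic_number G \<le> card A"
    unfolding chromatic_number_def by (intro Least_le) blast
  with assms(3) show False by simp
qed

text \<open>The least number is attained because numbering the vertices shows that some number of
  colors suffices.\<close>

lemma chromatic_coloring_exists:
  assumes "pair_graph G"
  obtains c where "c \<in> pverts G \<rightarrow> {..<chromatic_number G}" "proper_coloring G c"
proof -
  interpret pair_graph G by fact
  obtain h where h: "bij_betw h (pverts G) {0..<card (pverts G)}"
    using ex_bij_betw_finite_nat[OF pair_finite_verts] by blast
  have "h \<in> pverts G \<rightarrow> {..<card (pverts G)}"
    using h by (auto dest: bij_betwE)
  moreover have "proper_coloring G h"
    unfolding proper_coloring_def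
  proof (intro allI impI)
    fix u v assume "(u, v) \<in> parcs G"
    then have "u \<in> pverts G" "v \<in> pverts G" "u \<noteq> v"
      by (auto dest: in_arcsD1 in_arcsD2 no_loops')
    then show "h u \<noteq> h v"
      using h by (auto simp: bij_betw_def inj_on_def)
  qed
  ultimately have "\<exists>n. \<exists>c :: 'a \<Rightarrow> nat. c \<in> pverts G \<rightarrow> {..<n} \<and> proper_coloring G c"
    by blast
  from LeastI_ex[OF this] that show thesis
    unfolding chromatic_number_def by blast
qed

section \<open>Colorings of the product with a complete bipartite graph\<close>

text \<open>Neither part of the bipartite graph has inner edges, so the copies of \<open>G\<close>
  over one part do not interact. All that a right copy sees of the left ones is the set of colors
  used at each vertex.\<close>

lemma list_colorable_product_complete_bipartite_iff:
  assumes "pair_graph G"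
  shows "list_colorable (G \<box> complete_bipartite a b) L \<longleftrightarrow>
    (\<exists>t \<in> (\<Pi>\<^sub>E i\<in>{..<a}. list_colorings G (\<lambda>v. L (v, Inl i))).
      \<forall>j<b. list_colorable G (\<lambda>v. L (v, Inr j) - (\<lambda>i. t i v) ` {..<a}))"
    (is "?lhs \<longleftrightarrow> ?rhs")
proof -
  interpret pair_graph G by fact
  note prod_iff = list_colorable_iff[OF pair_graph_cartesian_product[OF assms pair_graph_complete_bipartite]]
  note simps = cartesian_product_def complete_bipartite_def
  show ?thesis
  proof
    assume ?lhs
    then obtain c where c: "\<forall>x\<in>pverts (G \<box> complete_bipartite a b). c x \<in> L x"
      "proper_coloring (G \<box> complete_bipartite a b) c"
      using prod_iff by blast
    have arcD: "c x \<noteq> c y" if "(x, y) \<in> parcs (G \<box> complete_bipartite a b)" for x y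
      using c(2) that unfolding proper_coloring_def by blast
    define t where "t = (\<lambda>i\<in>{..<a}. \<lambda>v\<in>pverts G. c (v, Inl i))"
    have "t i \<in> list_colorings G (\<lambda>v. L (v, Inl i))" if "i < a" for i
    proof -
      have "c (u, Inl i) \<noteq> c (v, Inl i)" if "(u, v) \<in> parcs G" for u v
        using that \<open>i < a\<close> by (intro arcD) (auto simp: simps dest: in_arcsD1 in_arcsD2)
      then show ?thesis
        using c(1) that by (auto simp: t_def list_colorings_def proper_coloring_def simps
            dest: in_arcsD1 in_arcsD2)
    qed
    then have "t \<in> (\<Pi>\<^sub>E i\<in>{..<a}. list_colorings G (\<lambda>v. L (v, Inl i)))"
      by (auto simp: t_def)
    moreover have "list_colorable G (\<lambda>v. L (v, Inr j) - (\<lambda>i. t i v) ` {..<a})" if "j < b" for j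
      unfolding list_colorable_iff[OF assms]
    proof (intro exI[of _ "\<lambda>v. c (v, Inr j)"] conjI ballI)
      fix v assume v: "v \<in> pverts G"
      then have "c (v, Inr j) \<in> L (v, Inr j)"
        using c(1) that by (auto simp: simps)
      moreover have "c (v, Inr j) \<noteq> c (v, Inl i)" if "i < a" for i
        using that v \<open>j < b\<close> by (intro arcD) (auto simp: simps)
      ultimately show "c (v, Inr j) \<in> L (v, Inr j) - (\<lambda>i. t i v) ` {..<a}"
        using v by (auto simp: t_def)
    next
      show "proper_coloring G (\<lambda>v. c (v, Inr j))"
        using that by (auto simp: proper_coloring_def simps dest: in_arcsD1 in_arcsD2 intro!: arcD)
    qed
    ultimately show ?rhs by blast
  next
    assume ?rhs
    then obtain t where t: "t \<in> (\<Pi>\<^sub>E i\<in>{..<a}. list_colorings G (\<lambda>v. L (v, Inl i)))"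
      and "\<forall>j<b. list_colorable G (\<lambda>v. L (v, Inr j) - (\<lambda>i. t i v) ` {..<a})"
      by blast
    then have "\<forall>j<b. \<exists>d. (\<forall>v\<in>pverts G. d v \<in> L (v, Inr j) - (\<lambda>i. t i v) ` {..<a}) \<and> proper_coloring G d"
      by (simp only: list_colorable_iff[OF assms])
    then obtain d where d: "\<And>j v. j < b \<Longrightarrow> v \<in> pverts G \<Longrightarrow> d j v \<in> L (v, Inr j) - (\<lambda>i. t i v) ` {..<a}"
      "\<And>j. j < b \<Longrightarrow> proper_coloring G (d j)"
      by metis
    have t': "t i \<in> list_colorings G (\<lambda>v. L (v, Inl i))" if "i < a" for i
      using t that by auto
    have t'': "t i v \<in> L (v, Inl i)" if "i < a" "v \<in> pverts G" for i v
      using t'[OF that(1)] that(2) by (auto simp: list_colorings_def)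
    have dt: "d j v \<noteq> t i v" if "i < a" "j < b" "v \<in> pverts G" for i j v
      using d(1)[OF that(2,3)] that(1) by auto
    define c where "c = (\<lambda>(v, x). case x of Inl i \<Rightarrow> t i v | Inr j \<Rightarrow> d j v)"
    have "c x \<in> L x" if "x \<in> pverts (G \<box> complete_bipartite a b)" for x
      using that d(1) t'' by (auto simp: c_def simps)
    moreover have "proper_coloring (G \<box> complete_bipartite a b) c"
      unfolding proper_coloring_def
    proof (intro allI impI)
      fix x y assume "(x, y) \<in> parcs (G \<box> complete_bipartite a b)"
      then show "c x \<noteq> c y"
        using d(2) t' dt dt[symmetric]
        by (auto simp: c_def simps list_colorings_def proper_coloring_def)
    qed
    ultimately show ?lhs
      using prod_iff by blast
  qed
qed

section \<open>Connected strong chromatic-choosable graphs\<close>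

locale connected_strong_choosable =
  fixes M :: "'a pair_pre_digraph" and k :: nat
  assumes k_pos: "k \<ge> 1"
    and graph: "pair_graph M"
    and connected: "Digraph_Component.connected (with_proj M)"
    and strong: "strong_chromatic_choosable k M"
begin

sublocale pair_graph M by (rule graph)

lemma chromatic_number_eq: "chromatic_number M = k"
  using strong by (simp add: strong_chromatic_choosable_def)

lemma verts_nonempty: "pverts M \<noteq> {}"
proof
  assume e: "pverts M = {}"
  then have "list_colorable M (\<lambda>_. {} :: nat set)"
    using graph by (auto simp: list_colorable_iff proper_coloring_def dest: in_arcsD1)
  then show False
    using not_list_colorable_below_chromatic_number[OF graph, of "{} :: nat set"] k_pos chromatic_number_eq
    by auto
qed

lemma other_vertex_exists:
  assumes "k \<ge> 2"
  obtains u where "u \<in> pverts M" "u \<noteq> v"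
proof (rule ccontr)
  assume "\<not> thesis"
  with that have "pverts M \<subseteq> {v}" by blast
  then have "list_colorable M (\<lambda>_. {0 :: nat})"
    using graph by (auto simp: list_colorable_iff proper_coloring_def dest: in_arcsD1 in_arcsD2 no_loops' intro!: exI[of _ "\<lambda>_. 0"])
  then show False
    using not_list_colorable_below_chromatic_number[OF graph, of "{0 :: nat}"] assms chromatic_number_eq
    by auto
qed

text \<open>One color allows no arcs, and a connected graph without arcs is a point.\<close>

lemma single_vertex:
  assumes "k = 1" "u \<in> pverts M" "v \<in> pverts M"
  shows "u = v"
proof -
  obtain c where "c \<in> pverts M \<rightarrow> {..<1::nat}" "proper_coloring M c"
    using chromatic_coloring_exists[OF graph] chromatic_number_eq assms(1) by metis
  then have "c x = 0" if "x \<in> pverts M" for x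
    using that by auto
  with \<open>proper_coloring M c\<close> have "(x, y) \<notin> parcs M" for x y
    using in_arcsD1[of x y] in_arcsD2[of x y] by (metis proper_coloring_def)
  then have no_arcs: "parcs M = {}"
    by auto
  have "u \<rightarrow>\<^sup>*\<^bsub>mk_symmetric (with_proj M)\<^esub> v"
    using connected assms by (auto simp: connected_def strongly_connected_def)
  then show ?thesis
    using no_arcs by (cases rule: pre_digraph.converse_reachable_cases) (auto simp: parcs_mk_symmetric)
qed

text \<open>Connectedness matters only for \<open>k = 1\<close>, where an edgeless graph on several vertices would
  be a counterexample.\<close>

lemma uncolorable_imp_constant:
  fixes L :: "'a \<Rightarrow> nat set"
  assumes fin: "\<And>v. v \<in> pverts M \<Longrightarrow> finite (L v)"
    and card: "\<And>v. v \<in> pverts M \<Longrightarrow> k - 1 \<le> card (L v)"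
    and unc: "\<not> list_colorable M L"
  shows "\<exists>A. card A = k - 1 \<and> (\<forall>v\<in>pverts M. L v = A)"
proof (cases "k = 1")
  case True
  have "L v = {}" if "v \<in> pverts M" for v
  proof (rule ccontr)
    assume "L v \<noteq> {}"
    then obtain x where x: "x \<in> L v" by blast
    have "(\<forall>u\<in>pverts M. x \<in> L u) \<and> proper_coloring M (\<lambda>_. x)"
      using single_vertex[OF True] that x
      by (auto simp: proper_coloring_def dest: in_arcsD1 in_arcsD2 no_loops')
    then have "list_colorable M L"
      unfolding list_colorable_iff[OF graph] by (intro exI[of _ "\<lambda>_. x"])
    with unc show False by simp
  qed
  with True show ?thesis
    by (intro exI[of _ "{}"]) auto
next
  case False
  with k_pos have k2: "k \<ge> 2" by simp
  obtain B where B: "k_assignment M (k - 1) B" "\<And>v. v \<in> pverts M \<Longrightarrow> B v \<subseteq> L v"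
    using fin card by (elim k_subassignment_exists[of M L "k - 1", rotated]) auto
  \<comment> \<open>An assignment below \<open>L\<close> is uncolorable like \<open>L\<close>, so
    strength applies to all of them, not only to \<open>B\<close>.\<close>
  have const: "constant_assignment M C"
    if "k_assignment M (k - 1) C" "\<forall>v\<in>pverts M. C v \<subseteq> L v" for C
    using strong that list_colorable_mono[OF _ graph, of C L] unc
    by (auto simp: strong_chromatic_choosable_def)
  have constB: "constant_assignment M B"
    using B by (intro const) auto
  obtain w where w: "w \<in> pverts M" using verts_nonempty by blast
  have "L v = B w" if v: "v \<in> pverts M" for v
  proof (rule ccontr)
    have Bv: "B v = B w"
      using constB v w unfolding constant_assignment_def by blast
    assume "L v \<noteq> B w"
    with B(2)[OF v] Bv obtain x where x: "x \<in> L v" "x \<notin> B v" by blast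
    have cB: "finite (B v)" "card (B v) = k - 1"
      using B(1) v by (auto simp: k_assignment_def)
    with k2 obtain y where y: "y \<in> B v" by fastforce
    \<comment> \<open>Trading \<open>y\<close> for \<open>x\<close> at \<open>v\<close> alone stays
      below \<open>L\<close>, yet a second vertex keeps a list without \<open>x\<close>, so
      \<open>C\<close> is not constant.\<close>
    define C where "C = B(v := insert x (B v - {y}))"
    have "card (insert x (B v - {y})) = k - 1"
      using cB x y k2 by (simp add: card_insert_if)
    then have "k_assignment M (k - 1) C"
      using B(1) cB by (auto simp: k_assignment_def C_def)
    moreover have "\<forall>u\<in>pverts M. C u \<subseteq> L u"
      using B(2) x v by (auto simp: C_def)
    ultimately have "constant_assignment M C" by (rule const)
    moreover obtain u where u: "u \<in> pverts M" "u \<noteq> v"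
      using other_vertex_exists[OF k2] by blast
    ultimately have "C u = C v"
      using v unfolding constant_assignment_def by blast
    moreover have "B u = B v"
      using constB v u unfolding constant_assignment_def by blast
    ultimately show False
      using u x by (auto simp: C_def)
  qed
  with B(1) w show ?thesis
    by (intro exI[of _ "B w"]) (auto simp: k_assignment_def)
qed

text \<open>An uncolorable assignment would have only \<open>k - 1\<close> colors in every
  list.\<close>

lemma list_colorable_if_card_ge:
  fixes L :: "'a \<Rightarrow> nat set"
  assumes "\<And>v. v \<in> pverts M \<Longrightarrow> finite (L v)"
    and "\<And>v. v \<in> pverts M \<Longrightarrow> k \<le> card (L v)"
  shows "list_colorable M L"
proof (rule ccontr)
  assume unc: "\<not> list_colorable M L"
  have "k - 1 \<le> card (L v)" if "v \<in> pverts M" for v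
    using assms(2)[OF that] by simp
  from uncolorable_imp_constant[OF assms(1) this unc]
  obtain A where "card A = k - 1" "\<forall>v\<in>pverts M. L v = A"
    by auto
  with verts_nonempty assms(2) k_pos show False by fastforce
qed

lemma list_chromatic_number_eq: "list_chromatic_number M = k"
proof (rule list_chromatic_number_eqI[OF graph])
  show "k_assignment M (k - 1) (\<lambda>_. {..<k - 1})"
    by (simp add: k_assignment_def)
  show "\<not> list_colorable M (\<lambda>_. {..<k - 1})"
    using k_pos chromatic_number_eq
    by (intro not_list_colorable_below_chromatic_number[OF graph, of "{..<k - 1}"]) auto
qed (use k_pos in \<open>auto simp: k_assignment_def intro: list_colorable_if_card_ge\<close>)

lemma list_coloring_with_prescribed_color:
  fixes L :: "'a \<Rightarrow> nat set"
  assumes fin: "\<And>u. u \<in> pverts M \<Longrightarrow> finite (L u)"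
    and card: "\<And>u. u \<in> pverts M \<Longrightarrow> k \<le> card (L u)"
    and v: "v \<in> pverts M" and x: "x \<in> L v"
  obtains c where "c \<in> list_colorings M L" "c v = x"
proof -
  text \<open>The list at \<open>v\<close> is made larger than \<open>k\<close>, so that a coloring exists; since \<open>x\<close> is deleted
    everywhere else, \<open>v\<close> can afterwards be recolored with \<open>x\<close>.\<close>
  define L' where "L' = (\<lambda>u. L u - {x})(v := {..k})"
  have "list_colorable M L'"
  proof (rule ccontr)
    assume unc: "\<not> list_colorable M L'"
    have fin': "finite (L' u)" if "u \<in> pverts M" for u
      using fin that v by (auto simp: L'_def)
    have big: "k < card (L' v)"
    proof -
      have "card {..k} \<le> card (L' v)"
        using fin'[OF v] by (intro card_mono) (auto simp: L'_def)
      then show ?thesis by simp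
    qed
    have "k - 1 \<le> card (L' u)" if "u \<in> pverts M" for u
      using card[OF that] fin[OF that] big by (auto simp: L'_def card_Diff_singleton_if)
    \<comment> \<open>Every list would have \<open>k - 1\<close> colors, against the
      \<open>k + 1\<close> at \<open>v\<close>.\<close>
    from uncolorable_imp_constant[OF fin' this unc]
    obtain A where "card A = k - 1" "\<forall>u\<in>pverts M. L' u = A"
      by auto
    with big v show False by auto
  qed
  then obtain c where c: "\<forall>u\<in>pverts M. c u \<in> L' u" "proper_coloring M c"
    by (auto simp: list_colorable_iff[OF graph])
  define d where "d = restrict (c(v := x)) (pverts M)"
  have "d \<in> Pi\<^sub>E (pverts M) L"
    using c(1) x by (auto simp: d_def L'_def split: if_splits)
  moreover have "proper_coloring M d"
    unfolding proper_coloring_def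
  proof (intro allI impI)
    fix u w assume uw: "(u, w) \<in> parcs M"
    then have "u \<in> pverts M" "w \<in> pverts M" "u \<noteq> w" "c u \<noteq> c w"
      using c(2) by (auto simp: proper_coloring_def dest: in_arcsD1 in_arcsD2 no_loops')
    then show "d u \<noteq> d w"
      using c(1) by (auto simp: d_def L'_def split: if_splits)
  qed
  ultimately show thesis
    using v by (intro that[of d]) (auto simp: list_colorings_def d_def)
qed

section \<open>Counting bad tuples of colorings\<close>

lemma uncolorable_product_bound:
  fixes L :: "'a \<times> (nat + nat) \<Rightarrow> nat set"
  assumes L: "k_assignment (M \<box> complete_bipartite a b) (k + a - 1) L"
    and unc: "\<not> list_colorable (M \<box> complete_bipartite a b) L"
  shows "list_color_function M (k + a - 1) ^ a \<le> b * 2 ^ (k - 1)"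
proof -
  have left: "finite (L (v, Inl i))" "card (L (v, Inl i)) = k + a - 1"
    if "v \<in> pverts M" "i < a" for v i
    using L that by (auto simp: k_assignment_def cartesian_product_def complete_bipartite_def)
  have right: "finite (L (v, Inr j))" "card (L (v, Inr j)) = k + a - 1"
    if "v \<in> pverts M" "j < b" for v j
    using L that by (auto simp: k_assignment_def cartesian_product_def complete_bipartite_def)
  define N where "N = (\<lambda>i. list_colorings M (\<lambda>v. L (v, Inl i)))"
  define T where "T = (\<Pi>\<^sub>E i\<in>{..<a}. N i)"
  define D where "D = (\<lambda>t (v :: 'a). (\<lambda>i. t i v :: nat) ` {..<a})"
  \<comment> \<open>Badness is stated through the shape of the remaining lists, since this is all
    that the count uses; uncolorability implies it.\<close>
  define bad where "bad = (\<lambda>j. {t \<in> T. \<exists>A. card A = k - 1 \<and> (\<forall>v\<in>pverts M. L (v, Inr j) - D t v = A)})"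

  have fin_N: "finite (N i)" if "i < a" for i
    unfolding N_def using left(1) that by (intro finite_list_colorings graph)
  then have fin_T: "finite T"
    unfolding T_def by (intro finite_PiE) auto
  have T_in: "t i v \<in> L (v, Inl i)" if "t \<in> T" "i < a" "v \<in> pverts M" for t i v
    using that by (auto simp: T_def N_def list_colorings_def PiE_def Pi_def)
  have N_ex: "\<exists>c\<in>N i. c v = x" if "i < a" "v \<in> pverts M" "x \<in> L (v, Inl i)" for i v x
  proof -
    have "k \<le> card (L (u, Inl i))" if "u \<in> pverts M" for u
      using left(2)[OF that \<open>i < a\<close>] \<open>i < a\<close> by simp
    from list_coloring_with_prescribed_color[of "\<lambda>v. L (v, Inl i)", OF left(1)[OF _ \<open>i < a\<close>] this that(2,3)]
    show ?thesis unfolding N_def by blast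
  qed

  have T_bad: "\<exists>j<b. t \<in> bad j" if t: "t \<in> T" for t
  proof -
    obtain j where j: "j < b" "\<not> list_colorable M (\<lambda>v. L (v, Inr j) - D t v)"
      using unc t unfolding list_colorable_product_complete_bipartite_iff[OF graph] T_def N_def D_def
      by blast
    have "k - 1 \<le> card (L (v, Inr j) - D t v)" if "v \<in> pverts M" for v
    proof -
      have "card (D t v) \<le> a"
        unfolding D_def by (metis card_image_le card_lessThan finite_lessThan)
      then show ?thesis
        using diff_card_le_card_Diff[of "D t v" "L (v, Inr j)"] right(2)[OF that j(1)]
        by (simp add: D_def)
    qed
    from uncolorable_imp_constant[OF finite_Diff[OF right(1)[OF _ j(1)]] this j(2)] t j(1)
    show ?thesis
      by (auto simp: bad_def)
  qed

  \<comment> \<open>Going from \<open>k + a - 1\<close> to \<open>k - 1\<close> colors removes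
    exactly \<open>a\<close>. As \<open>D t v\<close> has at most \<open>a\<close> elements, they
    are \<open>a\<close> different colors, all in the list.\<close>
  have bad_inj: "inj_on (\<lambda>i. t i v) {..<a}" and bad_sub: "D t v \<subseteq> L (v, Inr j)"
    if "t \<in> bad j" "j < b" and v: "v \<in> pverts M" for t j v
  proof -
    have "card (L (v, Inr j) - D t v) = k - 1"
      using that by (auto simp: bad_def)
    then have "card (L (v, Inr j) \<inter> D t v) = a"
      using card_Int_Diff[OF right(1)[OF v \<open>j < b\<close>], of "D t v"] right(2)[OF v \<open>j < b\<close>] k_pos by simp
    moreover have "card (L (v, Inr j) \<inter> D t v) \<le> card (D t v)"
      by (intro card_mono) (auto simp: D_def)
    moreover have "card (D t v) \<le> a"
      unfolding D_def by (metis card_image_le card_lessThan finite_lessThan)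
    ultimately have "card (D t v) = a" "L (v, Inr j) \<inter> D t v = D t v"
      using card_subset_eq[of "D t v" "L (v, Inr j) \<inter> D t v"] by (auto simp: D_def)
    then show "inj_on (\<lambda>i. t i v) {..<a}" "D t v \<subseteq> L (v, Inr j)"
      by (auto intro!: eq_card_imp_inj_on simp: D_def)
  qed

  text \<open>A color common to two left lists at \<open>v\<close> could be used twice there, and then no right copy
    would be bad.\<close>
  have disj: "i = i'"
    if i: "i < a" "i' < a" and v: "v \<in> pverts M" and x: "x \<in> L (v, Inl i)" "x \<in> L (v, Inl i')" for i i' v x
  proof -
    \<comment> \<open>Every left copy whose list at \<open>v\<close> contains \<open>x\<close> uses
      it there, in particular \<open>i\<close> and \<open>i'\<close>. In the others any available
      color is prescribed, merely to get some coloring.\<close>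
    have "\<exists>c. c \<in> N l \<and> (x \<in> L (v, Inl l) \<longrightarrow> c v = x)" if "l < a" for l
    proof (cases "x \<in> L (v, Inl l)")
      case True
      then show ?thesis using N_ex[OF that v] by blast
    next
      case False
      have "card (L (v, Inl l)) \<noteq> 0"
        using left(2)[OF v that] k_pos that by simp
      then obtain y where "y \<in> L (v, Inl l)"
        by (metis card.empty ex_in_conv)
      then show ?thesis using N_ex[OF that v] False by blast
    qed
    then obtain c where c: "\<And>l. l < a \<Longrightarrow> c l \<in> N l \<and> (x \<in> L (v, Inl l) \<longrightarrow> c l v = x)"
      by metis
    define t where "t = restrict c {..<a}"
    have "t \<in> T"
      using c by (auto simp: t_def T_def)
    then obtain j where "j < b" "t \<in> bad j"
      using T_bad by blast
    then have "inj_on (\<lambda>i. t i v) {..<a}"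
      using bad_inj v by blast
    moreover have "t i v = t i' v"
      using c i x by (simp add: t_def)
    ultimately show ?thesis
      using i by (auto dest: inj_onD)
  qed

  obtain w where w: "w \<in> pverts M" using verts_nonempty by blast

  have card_bad: "card (bad j) \<le> 2 ^ (k - 1)" if j: "j < b" for j
  proof (cases "bad j = {}")
    case False
    \<comment> \<open>\<open>S i\<close> holds the colors that a bad tuple can use at
      \<open>w\<close> in the left copy \<open>i\<close>.\<close>
    define S where "S = (\<lambda>i. L (w, Inr j) \<inter> L (w, Inl i))"
    define val where "val = (\<lambda>t. \<lambda>i\<in>{..<a}. t i w :: nat)"
    have fin_S: "finite (S i)" for i
      using right(1)[OF w j] by (simp add: S_def)
    have val_in: "val t \<in> (\<Pi>\<^sub>E i\<in>{..<a}. S i)" if "t \<in> bad j" for t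
    proof -
      have "t \<in> T" using that by (simp add: bad_def)
      then show ?thesis
        using bad_sub[OF that j w] T_in[OF _ _ w] by (auto simp: val_def S_def D_def)
    qed
    \<comment> \<open>The values at \<open>w\<close> determine the common list \<open>A\<close>, and \<open>t i v\<close> is then the only color of
      \<open>L (v, Inr j) - A\<close> that lies in \<open>L (v, Inl i)\<close>.\<close>
    have "inj_on val (bad j)"
    proof (rule inj_onI)
      fix t t' assume t: "t \<in> bad j" and t': "t' \<in> bad j" and eq: "val t = val t'"
      have tT: "t \<in> T" "t' \<in> T" using t t' by (auto simp: bad_def)
      have "t i w = t' i w" if "i < a" for i
        using fun_cong[OF eq, of i] that by (simp add: val_def)
      then have Dw: "D t w = D t' w"
        by (auto simp: D_def)
      have Dv: "D t v = D t' v" if v: "v \<in> pverts M" for v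
      proof -
        have "L (v, Inr j) - D t v = L (w, Inr j) - D t w"
          using t v w by (auto simp: bad_def)
        moreover have "L (v, Inr j) - D t' v = L (w, Inr j) - D t' w"
          using t' v w by (auto simp: bad_def)
        ultimately show ?thesis
          using Dw bad_sub[OF t j v] bad_sub[OF t' j v] by blast
      qed
      have eq_at: "t i v = t' i v" if i: "i < a" and v: "v \<in> pverts M" for i v
      proof -
        have "t i v \<in> D t' v"
          using Dv[OF v] i by (auto simp: D_def)
        then obtain i' where i': "i' < a" "t i v = t' i' v"
          by (auto simp: D_def)
        then have "i = i'"
          using disj[OF i i'(1) v T_in[OF tT(1) i v]] T_in[OF tT(2) i'(1) v] by simp
        with i' show ?thesis by simp
      qed
      have "t i = t' i" if i: "i < a" for i
      proof (rule PiE_ext)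
        show "t i \<in> (\<Pi>\<^sub>E v\<in>pverts M. L (v, Inl i))" "t' i \<in> (\<Pi>\<^sub>E v\<in>pverts M. L (v, Inl i))"
          using tT i by (auto simp: T_def N_def list_colorings_def PiE_def Pi_def)
      qed (rule eq_at[OF i])
      then show "t = t'"
        using tT unfolding T_def by (intro PiE_ext[of t _ N t']) auto
    qed
    then have "card (bad j) \<le> card (\<Pi>\<^sub>E i\<in>{..<a}. S i)"
      using val_in fin_S by (intro card_inj_on_le[of val]) (auto intro: finite_PiE)
    also have "\<dots> = (\<Prod>i<a. card (S i))"
      by (simp add: card_PiE)
    also have "\<dots> \<le> (\<Prod>i<a. 2 ^ (card (S i) - 1))"
    proof (intro prod_mono conjI)
      fix i
      \<comment> \<open>This is \<open>n < 2 ^ n\<close> with \<open>n = card (S i) - 1\<close>;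
        truncated subtraction also covers an empty \<open>S i\<close>.\<close>
      have "card (S i) - 1 < 2 ^ (card (S i) - 1)" by (rule less_exp)
      then show "card (S i) \<le> 2 ^ (card (S i) - 1)" by linarith
    qed simp
    also have "\<dots> = 2 ^ (\<Sum>i<a. card (S i) - 1)"
      by (simp add: power_sum)
    also have "\<dots> \<le> 2 ^ (k - 1)"
    proof (rule power_increasing)
      \<comment> \<open>A bad tuple picks a color from each \<open>S i\<close>, so no subtraction
        below is truncated and the sum drops by exactly \<open>a\<close>.\<close>
      obtain t where "t \<in> bad j" using False by blast
      then have "S i \<noteq> {}" if "i < a" for i
        using val_in that by (auto simp: PiE_def Pi_def)
      then have "1 \<le> card (S i)" if "i < a" for i
        using that fin_S by (simp add: Suc_le_eq card_gt_0_iff)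
      then have "(\<Sum>i<a. card (S i) - 1) = (\<Sum>i<a. card (S i)) - a"
        using sum_subtractf_nat[of "{..<a}" "\<lambda>_. 1" "\<lambda>i. card (S i)"] by simp
      \<comment> \<open>The \<open>S i\<close> are disjoint parts of one list of
        \<open>k + a - 1\<close> colors, which leaves \<open>k - 1\<close> after subtracting
        \<open>a\<close>.\<close>
      moreover have "(\<Sum>i<a. card (S i)) = card (\<Union>i<a. S i)"
        using fin_S disj[OF _ _ w] by (intro card_UN_disjoint[symmetric]) (auto simp: S_def)
      moreover have "card (\<Union>i<a. S i) \<le> k + a - 1"
        unfolding right(2)[OF w j, symmetric] using right(1)[OF w j]
        by (intro card_mono) (auto simp: S_def)
      ultimately show "(\<Sum>i<a. card (S i) - 1) \<le> k - 1" by linarith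
    qed simp
    finally show ?thesis .
  qed simp

  have "list_color_function M (k + a - 1) ^ a = (\<Prod>i<a. list_color_function M (k + a - 1))"
    by simp
  also have "\<dots> \<le> (\<Prod>i<a. card (N i))"
    unfolding N_def using left
    by (intro prod_mono conjI list_color_function_le) (auto simp: k_assignment_def)
  also have "\<dots> = card T"
    by (simp add: T_def card_PiE)
  also have "\<dots> \<le> card (\<Union>j<b. bad j)"
  proof (rule card_mono)
    show "finite (\<Union>j<b. bad j)"
      by (rule finite_subset[OF _ fin_T]) (auto simp: bad_def)
    show "T \<subseteq> (\<Union>j<b. bad j)"
      using T_bad by blast
  qed
  also have "\<dots> \<le> (\<Sum>j<b. card (bad j))"
    by (rule card_UN_le) simp
  also have "\<dots> \<le> b * 2 ^ (k - 1)"
    using sum_bounded_above[of "{..<b}" "\<lambda>j. card (bad j)" "2 ^ (k - 1)"] card_bad by simp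
  finally show ?thesis .
qed

section \<open>The value \<open>k + a\<close> is attained\<close>

text \<open>Any tuple on the left removes at most \<open>a\<close> of the \<open>k + a\<close>
  colors at a vertex of a right copy, and \<open>k\<close> colors suffice there.\<close>

lemma product_choosable:
  fixes L :: "'a \<times> (nat + nat) \<Rightarrow> nat set"
  assumes L: "k_assignment (M \<box> complete_bipartite a b) (k + a) L"
  shows "list_colorable (M \<box> complete_bipartite a b) L"
proof -
  have left: "finite (L (v, Inl i))" "card (L (v, Inl i)) = k + a"
    if "v \<in> pverts M" "i < a" for v i
    using L that by (auto simp: k_assignment_def cartesian_product_def complete_bipartite_def)
  have right: "finite (L (v, Inr j))" "card (L (v, Inr j)) = k + a"
    if "v \<in> pverts M" "j < b" for v j
    using L that by (auto simp: k_assignment_def cartesian_product_def complete_bipartite_def)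
  have "list_colorable M (\<lambda>v. L (v, Inl i))" if "i < a" for i
    using left that by (intro list_colorable_if_card_ge) auto
  then have "(\<Pi>\<^sub>E i\<in>{..<a}. list_colorings M (\<lambda>v. L (v, Inl i))) \<noteq> {}"
    by (auto simp: PiE_eq_empty_iff list_colorable_def)
  then obtain t where t: "t \<in> (\<Pi>\<^sub>E i\<in>{..<a}. list_colorings M (\<lambda>v. L (v, Inl i)))"
    by blast
  have "list_colorable M (\<lambda>v. L (v, Inr j) - (\<lambda>i. t i v) ` {..<a})" if j: "j < b" for j
  proof (rule list_colorable_if_card_ge)
    fix v assume v: "v \<in> pverts M"
    show "finite (L (v, Inr j) - (\<lambda>i. t i v) ` {..<a})"
      using right(1)[OF v j] by simp
    have "card ((\<lambda>i. t i v) ` {..<a}) \<le> a"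
      by (metis card_image_le card_lessThan finite_lessThan)
    then show "k \<le> card (L (v, Inr j) - (\<lambda>i. t i v) ` {..<a})"
      using diff_card_le_card_Diff[of "(\<lambda>i. t i v) ` {..<a}" "L (v, Inr j)"] right(2)[OF v j] by simp
  qed
  with t show ?thesis
    unfolding list_colorable_product_complete_bipartite_iff[OF graph] by blast
qed

lemma uncolorable_product_exists:
  obtains b and L :: "'a \<times> (nat + nat) \<Rightarrow> nat set"
  where "b \<ge> 1" "k_assignment (M \<box> complete_bipartite a b) (k + a - 1) L"
    "\<not> list_colorable (M \<box> complete_bipartite a b) L"
proof (cases "a = 0")
  case True
  \<comment> \<open>Without left copies, one right copy with too few colors is enough;
    \<open>b\<close> must still be positive.\<close>
  have "\<not> list_colorable (M \<box> complete_bipartite a 1) (\<lambda>_. {..<k - 1})"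
    using not_list_colorable_below_chromatic_number[OF graph, of "{..<k - 1}" "\<lambda>_. {..<k - 1}"] k_pos
      chromatic_number_eq True
    by (simp add: list_colorable_product_complete_bipartite_iff[OF graph])
  then show thesis
    using True by (intro that[of 1 "\<lambda>_. {..<k - 1}"]) (auto simp: k_assignment_def)
next
  case False
  define m where "m = k + a - 1"
  have m: "k \<le> m" "1 \<le> m" using False k_pos by (auto simp: m_def)
  \<comment> \<open>Consecutive blocks of length \<open>m\<close> serve as disjoint left lists, and
    \<open>A\<close> starts after the last block.\<close>
  define I where "I = (\<lambda>i. {i * m..<Suc i * m})"
  define A where "A = {a * m..<a * m + (k - 1)}"
  define T where "T = (\<Pi>\<^sub>E i\<in>{..<a}. list_colorings M (\<lambda>_. I i))"
  have "finite T"
    unfolding T_def by (intro finite_PiE finite_list_colorings graph) (auto simp: I_def)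
  moreover have "list_colorable M (\<lambda>_. I i)" for i
    using m by (intro list_colorable_if_card_ge) (auto simp: I_def)
  then have "T \<noteq> {}"
    by (auto simp: T_def PiE_eq_empty_iff list_colorable_def)
  ultimately have b: "card T \<ge> 1"
    by (simp add: Suc_le_eq card_gt_0_iff)
  \<comment> \<open>The right copies are indexed by the tuples in \<open>T\<close>, so
    \<open>b = card T\<close>.\<close>
  obtain h where h: "bij_betw h {0..<card T} T"
    using ex_bij_betw_nat_finite[OF \<open>finite T\<close>] by blast
  define D where "D = (\<lambda>t (v :: 'a). (\<lambda>i. t i v :: nat) ` {..<a})"
  define L where "L = (\<lambda>(v, x). case x of Inl i \<Rightarrow> I i | Inr j \<Rightarrow> D (h j) v \<union> A)"
  have T_in: "t i v \<in> I i" if "t \<in> T" "i < a" "v \<in> pverts M" for t i v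
    using that by (auto simp: T_def list_colorings_def PiE_def Pi_def)
  have I_disj: "i = i'" if "x \<in> I i" "x \<in> I i'" for i i' x
  proof -
    have "x div m = l" if "x \<in> I l" for l
      using that m by (intro div_nat_eqI) (auto simp: I_def mult.commute)
    with that show ?thesis by blast
  qed
  have I_less: "x < a * m" if "x \<in> I i" "i < a" for x i
  proof -
    have "x < Suc i * m" using that by (auto simp: I_def)
    also have "\<dots> \<le> a * m" using that by (intro mult_right_mono) auto
    finally show ?thesis .
  qed
  have card_right: "card (D t v \<union> A) = m" if t: "t \<in> T" and v: "v \<in> pverts M" for t v
  proof -
    have "inj_on (\<lambda>i. t i v) {..<a}"
      using T_in[OF t _ v] by (intro inj_onI) (metis I_disj lessThan_iff)
    then have "card (D t v) = a"
      by (simp add: D_def card_image)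
    moreover have "D t v \<inter> A = {}"
      using T_in[OF t _ v] I_less by (fastforce simp: D_def A_def)
    ultimately have "card (D t v \<union> A) = a + (k - 1)"
      by (subst card_Un_disjoint) (auto simp: D_def A_def)
    then show ?thesis using k_pos by (simp add: m_def)
  qed
  have "k_assignment (M \<box> complete_bipartite a (card T)) m L"
    using card_right bij_betwE[OF h]
    by (auto simp: k_assignment_def cartesian_product_def complete_bipartite_def L_def I_def D_def A_def)
  moreover have "\<not> list_colorable (M \<box> complete_bipartite a (card T)) L"
  proof
    assume "list_colorable (M \<box> complete_bipartite a (card T)) L"
    then obtain t where t: "t \<in> T"
      and col: "\<And>j. j < card T \<Longrightarrow> list_colorable M (\<lambda>v. (D (h j) v \<union> A) - D t v)"
      unfolding list_colorable_product_complete_bipartite_iff[OF graph] T_def L_def D_def by auto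
    obtain j where j: "j < card T" "h j = t"
      using h t by (metis atLeastLessThan_iff bij_betw_imp_surj_on imageE)
    \<comment> \<open>The copy belonging to \<open>t\<close> itself keeps only colors of
      \<open>A\<close>, fewer than the chromatic number.\<close>
    have "\<not> list_colorable M (\<lambda>v. (D (h j) v \<union> A) - D t v)"
      using k_pos chromatic_number_eq j
      by (intro not_list_colorable_below_chromatic_number[OF graph, of A]) (auto simp: A_def)
    with col j show False by blast
  qed
  ultimately show thesis
    using b by (intro that[of "card T" L]) (auto simp: m_def)
qed

text \<open>The construction above makes the set under \<open>LEAST\<close> nonempty, so its least
  element has the defining property.\<close>

lemma f_number_witness:
  "f_number a M \<ge> 1 \<and> list_chromatic_number (M \<box> complete_bipartite a (f_number a M)) = k + a"
proof -
  obtain b and L :: "'a \<times> (nat + nat) \<Rightarrow> nat set"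
    where b: "b \<ge> 1" "k_assignment (M \<box> complete_bipartite a b) (k + a - 1) L"
      "\<not> list_colorable (M \<box> complete_bipartite a b) L"
    by (rule uncolorable_product_exists)
  have "list_chromatic_number (M \<box> complete_bipartite a b) = k + a"
    using k_pos b(2,3)
    by (intro list_chromatic_number_eqI[OF pair_graph_cartesian_product[OF graph pair_graph_complete_bipartite]]
        product_choosable) auto
  with b(1) have "\<exists>b. b \<ge> 1 \<and>
      list_chromatic_number (M \<box> complete_bipartite a b) = list_chromatic_number M + a"
    by (auto simp: list_chromatic_number_eq)
  from LeastI_ex[OF this] show ?thesis
    unfolding f_number_def by (simp add: list_chromatic_number_eq)
qed

text \<open>At \<open>b = f_number a M\<close> the list chromatic number exceeds
  \<open>k + a - 1\<close>, so an uncolorable assignment exists to which the count applies.\<close>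

lemma list_color_function_power_le:
  "list_color_function M (k + a - 1) ^ a \<le> f_number a M * 2 ^ (k - 1)"
proof -
  have "\<not> list_chromatic_number (M \<box> complete_bipartite a (f_number a M)) \<le> k + a - 1"
    using f_number_witness[of a] k_pos by simp
  then obtain L :: "'a \<times> (nat + nat) \<Rightarrow> nat set"
    where "k_assignment (M \<box> complete_bipartite a (f_number a M)) (k + a - 1) L"
      "\<not> list_colorable (M \<box> complete_bipartite a (f_number a M)) L"
    using list_chromatic_number_le by blast
  then show ?thesis
    by (rule uncolorable_product_bound)
qed

end

theorem theorem1p12:
  fixes a k :: nat and M :: "'a pair_pre_digraph"
  assumes "a \<ge> 1" and "k \<ge> 1"
    and "pair_graph M"
    and "Digraph_Component.connected (with_proj M)"
    and "strong_chromatic_choosable k M"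
  shows "real (list_color_function M (k + a - 1)) ^ a / 2 ^ (k - 1) \<le> real (f_number a M)"
proof -
  interpret connected_strong_choosable M k
    by (intro connected_strong_choosable.intro assms)
  have "real (list_color_function M (k + a - 1) ^ a) \<le> real (f_number a M * 2 ^ (k - 1))"
    using list_color_function_power_le[of a] by (simp only: of_nat_le_iff)
  then show ?thesis
    by (simp add: divide_le_eq)
qed

end
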